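(* Let $\mu\in\mathbb R$, $\sigma>0$, $a\in\mathbb R$, $\kappa>0$, $B>0$, $\alpha\in(0,1)$. Let $U(x)=\min\bigl(\kappa(x-a)_+,B\bigr)$, $\bar a:=a+B/\kappa$, $\varphi(u)=\max\{0,(u-\alpha)/(1-\alpha)\}$, and $$U_\alpha=\mu+\sigma\sqrt{\frac{\alpha}{1-\alpha}},\qquad T_\alpha=\mu+\sigma\,\frac{2\alpha-1}{2\sqrt{\alpha(1-\alpha)}}.$$ Let $$S(a)=\begin{cases}\kappa(U_\alpha-a),&a\le T_\alpha,\\ \dfrac{\kappa}{2(1-\alpha)}\Bigl(\sqrt{(a-\mu)^2+\sigma^2}-(a-\mu)\Bigr),&a>T_\alpha,\end{cases}$$ which is the worst-case (supremum) value for the uncapped utility $\kappa(x-a)_+$ under the same distortion. Let $\Psi_{\max}$ and $\Psi_{\min}$ be the supremum and infimum of $M_{U,\varphi}(X)=\int_0^1U(F_X^{-1}(u))\,\mathrm d\varphi(u)$ over all random variables $X$ with mean $\mu$ and variance $\sigma^2$. Then $$\Psi_{\max}=\begin{cases}B,&\bar a\le U_\alpha,\\[2pt] \dfrac{B\sigma^2}{(1-\alpha)\bigl(\sigma^2+(\bar a-\mu)^2\bigr)},&\bar a>U_\alpha\text{ and }\sqrt{(a-\mu)^2+\sigma^2}\ge B/\kappa,\\[4pt] S(a),&\bar a>U_\alpha\text{ and }\sqrt{(a-\mu)^2+\sigma^2}<B/\kappa,\end{cases}$$ and it is attained by a two-point distribution. Moreover $\Psi_{\min}=0$ for $a\ge\mu$,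 attained by a two-point distribution supported on $(-\infty,a]$ when $a>\mu$ and approached when $a=\mu$; and $\Psi_{\min}>0$ for $a<\mu$.
   Context: $F_X^{-1}(u)=\inf\{t:F_X(t)\ge u\}$ is the quantile function of $X$; here $\mathrm d\varphi(u)=\frac1{1-\alpha}\mathbf 1_{(\alpha,1]}(u)\,\mathrm du$, so $M_{U,\varphi}(X)=\frac1{1-\alpha}\int_\alpha^1U(F_X^{-1}(u))\,\mathrm du$. $(x)_+:=\max\{x,0\}$. $U(\cdot)$ with an argument denotes the utility, while $U_\alpha$ is a real number. *)

theory Defs
  imports "HOL-Probability.Probability"
begin

definition quantile :: "'w measure \<Rightarrow> ('w \<Rightarrow> real) \<Rightarrow> real \<Rightarrow> real" where
  "quantile P X u = Inf {t. u \<le> cdf (distr P borel X) t}"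

text \<open>
  The integral against \<open>d\<phi>\<close> is the integral with respect to the Lebesgue-Stieltjes measure of
  \<open>\<phi>\<close>, so \<open>\<phi>\<close> should be nondecreasing and continuous. The endpoints 0 and 1, where the quantile
  may be infinite, are then null sets and are left out.
\<close>

definition distorted_utility ::
    "(real \<Rightarrow> real) \<Rightarrow> (real \<Rightarrow> real) \<Rightarrow> 'w measure \<Rightarrow> ('w \<Rightarrow> real) \<Rightarrow> real" where
  "distorted_utility U \<phi> P X = (LINT u:{0<..<1}|interval_measure \<phi>. U (quantile P X u))"

definition moment_class :: "real \<Rightarrow> real \<Rightarrow> ('w measure \<times> ('w \<Rightarrow> real)) set" where
  "moment_class \<mu> \<sigma> = {(P, X). prob_space P \<and> X \<in> borel_measurable P \<and>
     integrable P X \<and> integrable P (\<lambda>\<omega>. (X \<omega>)\<^sup>2) \<and>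
     prob_space.expectation P X = \<mu> \<and> prob_space.variance P X = \<sigma>\<^sup>2}"

text \<open>
  A random variable on an arbitrary sample space can be replaced by the identity on the real line
  equipped with its law. Hence the extremal values below are defined with sample spaces whose
  underlying type is \<open>real\<close>, without restricting the laws that occur.
\<close>

lemma quantile_distr:
  assumes "X \<in> borel_measurable P"
  shows "quantile (distr P borel X) (\<lambda>x. x) = quantile P X"
proof -
  have "distr (distr P borel X) borel (\<lambda>x. x) = distr P borel X"
    using assms by (subst distr_distr) (auto simp: comp_def)
  then show ?thesis
    by (simp add: quantile_def fun_eq_iff)
qed

lemma moment_class_distr:
  assumes "(P, X) \<in> moment_class \<mu> \<sigma>"
  shows "(distr P borel X, \<lambda>x. x) \<in> moment_class \<mu> \<sigma>"
    and "distorted_utility U \<phi> (distr P borel X) (\<lambda>x. x) = distorted_utility U \<phi> P X"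
proof -
  have X: "X \<in> borel_measurable P" and "prob_space P"
    using assms by (auto simp: moment_class_def)
  then have "prob_space (distr P borel X)"
    by (intro prob_space.prob_space_distr) auto
  then show "(distr P borel X, \<lambda>x. x) \<in> moment_class \<mu> \<sigma>"
    using assms by (auto simp: moment_class_def integrable_distr_eq integral_distr)
  show "distorted_utility U \<phi> (distr P borel X) (\<lambda>x. x) = distorted_utility U \<phi> P X"
    by (simp add: distorted_utility_def quantile_distr[OF X])
qed

text \<open>
  The extremal values are taken in \<^typ>\<open>ereal\<close>, where suprema and infima are genuine without
  any boundedness or nonemptiness conditions.
\<close>

definition Psi_max :: "(real \<Rightarrow> real) \<Rightarrow> (real \<Rightarrow> real) \<Rightarrow> real \<Rightarrow> real \<Rightarrow> ereal" where
  "Psi_max U \<phi> \<mu> \<sigma> = (SUP (P :: real measure, X) \<in> moment_class \<mu> \<sigma>.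
     ereal (distorted_utility U \<phi> P X))"

definition Psi_min :: "(real \<Rightarrow> real) \<Rightarrow> (real \<Rightarrow> real) \<Rightarrow> real \<Rightarrow> real \<Rightarrow> ereal" where
  "Psi_min U \<phi> \<mu> \<sigma> = (INF (P :: real measure, X) \<in> moment_class \<mu> \<sigma>.
     ereal (distorted_utility U \<phi> P X))"

definition two_point :: "'w measure \<Rightarrow> ('w \<Rightarrow> real) \<Rightarrow> bool" where
  "two_point P X \<longleftrightarrow> (\<exists>x y. x \<noteq> y \<and>
     0 < measure P {\<omega> \<in> space P. X \<omega> = x} \<and> 0 < measure P {\<omega> \<in> space P. X \<omega> = y} \<and>
     (AE \<omega> in P. X \<omega> = x \<or> X \<omega> = y))"

definition uncapped_utility :: "real \<Rightarrow> real \<Rightarrow> real \<Rightarrow> real" where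
  "uncapped_utility \<kappa> a x = \<kappa> * max (x - a) 0"

definition capped_utility :: "real \<Rightarrow> real \<Rightarrow> real \<Rightarrow> real \<Rightarrow> real" where
  "capped_utility \<kappa> a B x = min (\<kappa> * max (x - a) 0) B"

definition es_distortion :: "real \<Rightarrow> real \<Rightarrow> real" where
  "es_distortion \<alpha> u = max 0 ((u - \<alpha>) / (1 - \<alpha>))"

definition U_level :: "real \<Rightarrow> real \<Rightarrow> real \<Rightarrow> real" where
  "U_level \<mu> \<sigma> \<alpha> = \<mu> + \<sigma> * sqrt (\<alpha> / (1 - \<alpha>))"

definition T_level :: "real \<Rightarrow> real \<Rightarrow> real \<Rightarrow> real" where
  "T_level \<mu> \<sigma> \<alpha> = \<mu> + \<sigma> * ((2 * \<alpha> - 1) / (2 * sqrt (\<alpha> * (1 - \<alpha>))))"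

definition S_value :: "real \<Rightarrow> real \<Rightarrow> real \<Rightarrow> real \<Rightarrow> real \<Rightarrow> real" where
  "S_value \<mu> \<sigma> \<kappa> \<alpha> a =
     (if a \<le> T_level \<mu> \<sigma> \<alpha> then \<kappa> * (U_level \<mu> \<sigma> \<alpha> - a)
      else \<kappa> / (2 * (1 - \<alpha>)) * (sqrt ((a - \<mu>)\<^sup>2 + \<sigma>\<^sup>2) - (a - \<mu>)))"

end

theory Submission
  imports Defs
begin

text \<open>
  For \<open>\<phi> = es_distortion \<alpha>\<close> the distorted utility is the average of \<open>U (F\<^sup>-\<^sup>1 (u))\<close> over the tail
  \<open>\<alpha> < u < 1\<close>, where \<open>F\<^sup>-\<^sup>1\<close> is the quantile function of \<open>X\<close>. Since \<open>F\<^sup>-\<^sup>1\<close> transports the uniform law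
  to the law of \<open>X\<close> (\<open>distr_quantile\<close>), this average can be compared with expectations of
  functions of \<open>X\<close>, and expectations of quadratic functions are known.

  For the maximum, let \<open>U x \<le> t + c * (x - z)\<^sup>2\<close> for all \<open>x\<close>, with \<open>t, c \<ge> 0\<close>. The tail average is
  then at most \<open>t + c * (\<sigma>\<^sup>2 + (\<mu> - z)\<^sup>2) / (1 - \<alpha>)\<close>
  (\<open>distorted_utility_le_of_quadratic_majorant\<close>). A law with atoms at \<open>z\<close> and at a higher point
  where the majorant touches \<open>U\<close> attains this bound if the upper atom is exactly the tail, that is,
  has weight \<open>1 - \<alpha>\<close>; if \<open>t = 0\<close> and \<open>U z = 0\<close>, every smaller weight will do. The moments then
  fix the law. The constant \<open>B\<close>, a parabola that touches \<open>U\<close> where the cap is reached, and the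
  majorant of the uncapped hinge give the three cases of the formula. In the hinge case the kink is moved from \<open>a\<close> up to \<open>T_level\<close> when \<open>a\<close> is smaller, which
  is the case distinction in \<open>S_value\<close>; this majorant also settles the uncapped problem.

  For the minimum, monotonicity of \<open>U\<close> makes the tail average at least the plain expectation
  (\<open>expectation_le_distorted_utility\<close>). If \<open>a < \<mu>\<close>, a concave quadratic minorant of \<open>U\<close> bounds this
  expectation below by a positive number depending on the moments only. If \<open>a = \<mu>\<close>, a vanishing
  expectation would mean \<open>X \<le> \<mu>\<close> almost surely, hence \<open>X = \<mu>\<close>, which the variance forbids; yet two-point
  laws whose upper atom tends to \<open>\<mu>\<close> have values tending to \<open>0\<close>. If \<open>a > \<mu>\<close>, a two-point law below
  \<open>a\<close> has the value \<open>0\<close>.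
\<close>

section \<open>Quantiles as a random variable on the unit interval\<close>

lemma es_distortion_eq: "\<alpha> < 1 \<Longrightarrow> es_distortion \<alpha> u = max 0 (u - \<alpha>) / (1 - \<alpha>)"
  by (simp add: es_distortion_def max_def divide_le_0_iff zero_le_divide_iff)

lemma es_distortion_mono: "\<alpha> < 1 \<Longrightarrow> x \<le> y \<Longrightarrow> es_distortion \<alpha> x \<le> es_distortion \<alpha> y"
  unfolding es_distortion_def by (intro max.mono divide_right_mono) auto

text \<open>
  \<open>es_distortion \<alpha>\<close> is \<open>0\<close> up to \<open>\<alpha>\<close> and has slope \<open>1 / (1 - \<alpha>)\<close> afterwards, so its
  Stieltjes measure has that density. As both measures are determined by the half-open intervals,
  it is enough to compare increments there. The measure is infinite: \<open>es_distortion\<close> keeps growing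
  beyond \<open>1\<close>, and only the restriction to the unit interval enters a distorted utility.
\<close>

lemma interval_measure_es_distortion:
  assumes "\<alpha> < 1"
  shows "interval_measure (es_distortion \<alpha>) =
           density lborel (\<lambda>u. ennreal (indicator {\<alpha><..} u / (1 - \<alpha>)))"
    (is "?M = ?N")
proof (rule measure_eqI_generator_eq[where E = "range (\<lambda>(a, b). {a<..b::real})"
      and A = "\<lambda>i. {-real i<..real i}" and \<Omega> = UNIV])
  have Ioc: "emeasure ?M {a<..b} = es_distortion \<alpha> b - es_distortion \<alpha> a" if "a \<le> b" for a b
  proof (rule emeasure_interval_measure_Ioc[OF that])
    fix c
    have "continuous_on UNIV (es_distortion \<alpha>)"
      unfolding es_distortion_def using assms by (intro continuous_intros) auto
    then show "continuous (at_right c) (es_distortion \<alpha>)"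
      by (simp add: continuous_on_eq_continuous_within continuous_at_imp_continuous_at_within)
  qed (use es_distortion_mono[OF assms] in auto)
  show "Int_stable (range (\<lambda>(a, b). {a<..b::real}))"
    by (auto simp: Int_stable_def image_iff Int_greaterThanAtMost)
  show "emeasure ?M X = emeasure ?N X" if "X \<in> range (\<lambda>(a, b). {a<..b})" for X
  proof -
    from that obtain ab where "X = {fst ab<..snd ab}"
      by (elim imageE) (simp add: split_beta)
    then obtain a b where X: "X = {a<..b}" by blast
    show ?thesis
    proof (cases "a \<le> b")
      case True
      have "emeasure ?N X = (\<integral>\<^sup>+ u. ennreal (1 / (1 - \<alpha>)) * indicator {max a \<alpha><..b} u \<partial>lborel)"
        unfolding X by (subst emeasure_density)
          (auto intro!: nn_integral_cong split: split_indicator)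
      also have "\<dots> = ennreal (1 / (1 - \<alpha>)) * emeasure lborel {max a \<alpha><..b}"
        by (rule nn_integral_cmult_indicator) auto
      also have "\<dots> = ennreal (es_distortion \<alpha> b - es_distortion \<alpha> a)"
      proof (cases "max a \<alpha> \<le> b")
        case True
        then have "\<alpha> \<le> b" by simp
        then have "es_distortion \<alpha> b - es_distortion \<alpha> a = (1 / (1 - \<alpha>)) * (b - max a \<alpha>)"
          using assms by (auto simp: es_distortion_eq max_def diff_divide_distrib)
        with True show ?thesis using assms
          by (simp add: ennreal_mult[symmetric])
      next
        case False
        with \<open>a \<le> b\<close> have "b \<le> \<alpha>" "a \<le> \<alpha>" "{max a \<alpha><..b} = {}" by auto
        then show ?thesis by (simp add: es_distortion_eq assms)
      qed
      finally show ?thesis by (simp add: X Ioc True)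
    qed (simp add: X)
  qed
  show "(\<Union>i. {-real i<..real i}) = UNIV"
  proof (intro equalityI subsetI UNIV_I)
    fix x :: real
    obtain n where "\<bar>x\<bar> < real n" using reals_Archimedean2 by blast
    then have "x \<in> {-real n<..real n}" by auto
    then show "x \<in> (\<Union>i. {-real i<..real i})" by blast
  qed
  show "emeasure ?M {-real i<..real i} \<noteq> \<infinity>" for i
    by (simp add: Ioc)
qed (auto simp: borel_sigma_sets_Ioc)

abbreviation unit_lborel :: "real measure" where
  "unit_lborel \<equiv> restrict_space lborel {0<..<1}"

lemma prob_space_unit_lborel: "prob_space unit_lborel"
  by (auto simp: emeasure_restrict_space space_restrict_space intro!: prob_spaceI)

lemma measure_unit_lborel_greaterThan:
  assumes "0 \<le> \<alpha>" "\<alpha> \<le> 1"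
  shows "measure unit_lborel ({\<alpha><..} \<inter> {0<..<1}) = 1 - \<alpha>"
proof -
  have "{\<alpha><..} \<inter> {0<..<1} = {\<alpha><..<1}" using assms by auto
  with assms show ?thesis by (subst measure_restrict_space) auto
qed

lemma integral_unit_lborel_indicator_greaterThan:
  assumes "0 \<le> \<alpha>" "\<alpha> \<le> 1"
  shows "(LINT u|unit_lborel. indicator {\<alpha><..} u) = 1 - \<alpha>"
  using measure_unit_lborel_greaterThan[OF assms]
  by (simp add: space_restrict_space)

lemma indicator_greaterThan_unit_lborel_measurable [measurable]:
  "(indicator {\<alpha><..} :: real \<Rightarrow> real) \<in> borel_measurable unit_lborel"
  by (auto intro!: measurable_restrict_space1)

context
  fixes P :: "'w measure" and X :: "'w \<Rightarrow> real"
  assumes P: "prob_space P" and X: "X \<in> borel_measurable P"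
begin

lemma cdf_distribution_distr: "cdf_distribution (distr P borel X)"
proof -
  interpret prob_space P by (rule P)
  show ?thesis unfolding cdf_distribution_def using X by simp
qed

lemma quantile_mono: "mono_on {0<..<1} (quantile P X)"
proof -
  interpret cdf_distribution "distr P borel X" by (rule cdf_distribution_distr)
  show ?thesis using mono_I by (simp add: quantile_def[abs_def])
qed

lemma quantile_measurable: "quantile P X \<in> borel_measurable unit_lborel"
  using cdf_distribution.measurable_CI[OF cdf_distribution_distr]
  by (simp add: quantile_def[abs_def])

text \<open>
  This is the quantile coupling from Skorohod's theorem: the quantile function, evaluated at a
  uniform random variable, has the original law. It turns integrals of functions of the quantile
  into expectations.
\<close>

lemma distr_quantile: "distr unit_lborel borel (quantile P X) = distr P borel X"
  using cdf_distribution.distr_I_eq_M[OF cdf_distribution_distr]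
  by (simp add: quantile_def[abs_def])

lemma integral_quantile:
  fixes g :: "real \<Rightarrow> real"
  assumes "g \<in> borel_measurable borel"
  shows "(LINT u|unit_lborel. g (quantile P X u)) = (LINT \<omega>|P. g (X \<omega>))"
  using integral_distr[OF quantile_measurable assms] integral_distr[OF X assms]
  by (simp add: distr_quantile)

lemma integrable_quantile:
  fixes g :: "real \<Rightarrow> real"
  assumes "g \<in> borel_measurable borel"
  shows "integrable unit_lborel (\<lambda>u. g (quantile P X u)) \<longleftrightarrow> integrable P (\<lambda>\<omega>. g (X \<omega>))"
  using integrable_distr_eq[OF quantile_measurable assms] integrable_distr_eq[OF X assms]
  by (simp add: distr_quantile)

text \<open>
  The normal form in which all estimates are made: an integral over the unit probability space,
  where the distortion appears only as the weight \<open>indicator {\<alpha><..} u / (1 - \<alpha>)\<close>.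
\<close>

lemma distorted_utility_es:
  assumes U: "U \<in> borel_measurable borel" and "\<alpha> < 1"
  shows "distorted_utility U (es_distortion \<alpha>) P X =
    (LINT u|unit_lborel. indicator {\<alpha><..} u * U (quantile P X u)) / (1 - \<alpha>)"
proof -
  have "(\<lambda>u. U (quantile P X u)) \<in> borel_measurable unit_lborel"
    using measurable_compose[OF quantile_measurable U] .
  then have m: "(\<lambda>u. indicator {0<..<1} u *\<^sub>R U (quantile P X u)) \<in> borel_measurable lborel"
    by (subst (asm) borel_measurable_restrict_space_iff) auto
  have "distorted_utility U (es_distortion \<alpha>) P X =
    (LINT u|lborel. indicator {\<alpha><..} u / (1 - \<alpha>) * (indicator {0<..<1} u * U (quantile P X u)))"
    unfolding distorted_utility_def set_lebesgue_integral_def interval_measure_es_distortion[OF \<open>\<alpha> < 1\<close>]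
    using m \<open>\<alpha> < 1\<close> by (subst integral_density) auto
  also have "\<dots> = (LINT u|lborel. (indicator {0<..<1} u * (indicator {\<alpha><..} u * U (quantile P X u))) / (1 - \<alpha>))"
    by (intro Bochner_Integration.integral_cong) auto
  also have "\<dots> = (LINT u|unit_lborel. indicator {\<alpha><..} u * U (quantile P X u)) / (1 - \<alpha>)"
    by (subst integral_restrict_space) auto
  finally show ?thesis .
qed

end

section \<open>Two bounds valid for every law in the moment class\<close>

lemma moment_classD:
  assumes "(P, X) \<in> moment_class \<mu> \<sigma>"
  shows "prob_space P" "X \<in> borel_measurable P" "integrable P X" "integrable P (\<lambda>\<omega>. (X \<omega>)\<^sup>2)"
    "(LINT \<omega>|P. X \<omega>) = \<mu>" "(LINT \<omega>|P. (X \<omega>)\<^sup>2) = \<sigma>\<^sup>2 + \<mu>\<^sup>2"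
proof -
  show *: "prob_space P" "X \<in> borel_measurable P" "integrable P X" "integrable P (\<lambda>\<omega>. (X \<omega>)\<^sup>2)"
    "(LINT \<omega>|P. X \<omega>) = \<mu>"
    using assms by (auto simp: moment_class_def)
  have "prob_space.variance P X = \<sigma>\<^sup>2" using assms by (auto simp: moment_class_def)
  then show "(LINT \<omega>|P. (X \<omega>)\<^sup>2) = \<sigma>\<^sup>2 + \<mu>\<^sup>2"
    using prob_space.variance_eq[OF *(1,3,4)] *(5) by simp
qed

lemma moment_class_square_distance:
  assumes "(P, X) \<in> moment_class \<mu> \<sigma>"
  shows "integrable P (\<lambda>\<omega>. (X \<omega> - z)\<^sup>2)"
    and "(LINT \<omega>|P. (X \<omega> - z)\<^sup>2) = \<sigma>\<^sup>2 + (\<mu> - z)\<^sup>2"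
proof -
  note m = moment_classD[OF assms]
  interpret prob_space P by (rule m)
  have eq: "(\<lambda>\<omega>. (X \<omega> - z)\<^sup>2) = (\<lambda>\<omega>. (X \<omega>)\<^sup>2 - 2 * z * X \<omega> + z\<^sup>2)"
    by (auto simp: power2_eq_square algebra_simps)
  show "integrable P (\<lambda>\<omega>. (X \<omega> - z)\<^sup>2)"
    unfolding eq using m by auto
  show "(LINT \<omega>|P. (X \<omega> - z)\<^sup>2) = \<sigma>\<^sup>2 + (\<mu> - z)\<^sup>2"
    unfolding eq using m by (simp add: prob_space power2_eq_square algebra_simps)
qed

text \<open>
  The weak duality behind all upper bounds. The constant \<open>t\<close> is collected only over the tail of
  length \<open>1 - \<alpha>\<close>, whereas the nonnegative parabola may be integrated over the whole unit interval,
  where its integral depends on the two given moments only. A utility that is not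
  integrable along the quantile gets the default value \<open>0\<close>, which respects the bound as well.
\<close>

lemma distorted_utility_le_of_quadratic_majorant:
  assumes PX: "(P, X) \<in> moment_class \<mu> \<sigma>" and U: "U \<in> borel_measurable borel"
    and \<alpha>: "0 < \<alpha>" "\<alpha> < 1" and "0 \<le> t" "0 \<le> c"
    and maj: "\<And>x. U x \<le> t + c * (x - z)\<^sup>2"
  shows "distorted_utility U (es_distortion \<alpha>) P X \<le> t + c * (\<sigma>\<^sup>2 + (\<mu> - z)\<^sup>2) / (1 - \<alpha>)"
proof -
  note m = moment_classD[OF PX]
  interpret O: prob_space unit_lborel by (rule prob_space_unit_lborel)
  let ?q = "quantile P X"
  let ?m = "\<lambda>u. t * indicator {\<alpha><..} u + c * (?q u - z)\<^sup>2"
  have int: "integrable unit_lborel (\<lambda>u. (?q u - z)\<^sup>2)"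
    using integrable_quantile[OF m(1,2), of "\<lambda>x. (x - z)\<^sup>2"] moment_class_square_distance[OF PX] by simp
  have indi: "integrable unit_lborel (indicator {\<alpha><..} :: real \<Rightarrow> real)"
    by (rule O.integrable_const_bound[where B = 1]) auto
  have "(LINT u|unit_lborel. indicator {\<alpha><..} u * U (?q u)) \<le> (LINT u|unit_lborel. ?m u)"
  proof (rule integral_mono')
    show "indicator {\<alpha><..} u * U (?q u) \<le> ?m u" for u
      using maj[of "?q u"] \<open>0 \<le> c\<close> by (auto split: split_indicator)
  qed (use int indi assms in auto)
  also have "\<dots> = t * (1 - \<alpha>) + c * (\<sigma>\<^sup>2 + (\<mu> - z)\<^sup>2)"
    using int indi integral_unit_lborel_indicator_greaterThan[of \<alpha>] \<alpha>
      integral_quantile[OF m(1,2), of "\<lambda>x. (x - z)\<^sup>2"] moment_class_square_distance[OF PX, of z]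
    by simp
  finally have "distorted_utility U (es_distortion \<alpha>) P X \<le>
      (t * (1 - \<alpha>) + c * (\<sigma>\<^sup>2 + (\<mu> - z)\<^sup>2)) / (1 - \<alpha>)"
    using \<alpha> by (simp add: distorted_utility_es[OF m(1,2) U] divide_right_mono)
  also have "\<dots> = t + c * (\<sigma>\<^sup>2 + (\<mu> - z)\<^sup>2) / (1 - \<alpha>)"
    using \<alpha> by (simp add: add_divide_distrib)
  finally show ?thesis .
qed

text \<open>
  Averaging a nondecreasing function over the upper tail gives at least its average over the
  whole interval. This is Chebyshev's association inequality, obtained by integrating the product
  of \<open>indicator {\<alpha><..} u - (1 - \<alpha>)\<close> with the increment from \<open>\<alpha>\<close> to \<open>u\<close>: both factors change
  sign at \<open>\<alpha>\<close> in the same direction, and the first one has mean \<open>0\<close>.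
\<close>

lemma expectation_le_distorted_utility:
  assumes P: "prob_space P" and X: "X \<in> borel_measurable P"
    and U: "mono U" and int: "integrable P (\<lambda>\<omega>. U (X \<omega>))" and \<alpha>: "0 < \<alpha>" "\<alpha> < 1"
  shows "(LINT \<omega>|P. U (X \<omega>)) \<le> distorted_utility U (es_distortion \<alpha>) P X"
proof -
  have Um: "U \<in> borel_measurable borel" by (rule borel_measurable_mono[OF U])
  interpret O: prob_space unit_lborel by (rule prob_space_unit_lborel)
  define f where "f u = U (quantile P X u)" for u
  let ?i = "indicator {\<alpha><..} :: real \<Rightarrow> real"
  have f: "integrable unit_lborel f"
    unfolding f_def using int integrable_quantile[OF P X Um] by simp
  have indi: "integrable unit_lborel ?i"
    by (rule O.integrable_const_bound[where B = 1]) auto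
  have fi: "integrable unit_lborel (\<lambda>u. ?i u * f u)"
    by (rule Bochner_Integration.integrable_bound[OF f]) (use f in \<open>auto split: split_indicator\<close>)
  have "0 \<le> (LINT u|unit_lborel. (?i u - (1 - \<alpha>)) * (f u - f \<alpha>))"
  proof (rule Bochner_Integration.integral_nonneg)
    fix u assume "u \<in> space unit_lborel"
    then have u: "u \<in> {0<..<1}" by (simp add: space_restrict_space)
    have "f \<alpha> \<le> f u" if "\<alpha> < u"
      using monoD[OF U mono_onD[OF quantile_mono[OF P X]]] that u \<alpha> by (simp add: f_def)
    moreover have "f u \<le> f \<alpha>" if "u \<le> \<alpha>"
      using monoD[OF U mono_onD[OF quantile_mono[OF P X]]] that u \<alpha> by (simp add: f_def)
    ultimately show "0 \<le> (?i u - (1 - \<alpha>)) * (f u - f \<alpha>)"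
      using \<alpha> by (auto split: split_indicator intro: mult_nonpos_nonpos)
  qed
  also have "\<dots> = (LINT u|unit_lborel. ?i u * f u - f \<alpha> * ?i u - (1 - \<alpha>) * f u + (1 - \<alpha>) * f \<alpha>)"
    by (intro Bochner_Integration.integral_cong) (auto simp: algebra_simps)
  also have "\<dots> = (LINT u|unit_lborel. ?i u * f u) - (1 - \<alpha>) * (LINT u|unit_lborel. f u)"
    using f fi indi integral_unit_lborel_indicator_greaterThan[of \<alpha>] \<alpha> O.prob_space
    by simp
  finally have "(1 - \<alpha>) * (LINT u|unit_lborel. f u) \<le> (LINT u|unit_lborel. ?i u * f u)" by simp
  then show ?thesis
    using \<alpha> integral_quantile[OF P X Um]
    by (simp add: distorted_utility_es[OF P X Um] f_def field_simps)
qed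

lemma distorted_utility_nonneg: "(\<And>x. 0 \<le> U x) \<Longrightarrow> 0 \<le> distorted_utility U \<phi> P X"
  unfolding distorted_utility_def set_lebesgue_integral_def
  by (intro Bochner_Integration.integral_nonneg) auto

section \<open>Two-point laws with prescribed mean and variance\<close>

text \<open>
  Every two-point law with mean \<open>\<mu>\<close> and variance \<open>\<sigma>\<^sup>2\<close> arises here: once the upper atom
  \<open>\<mu> + h\<close> with \<open>h > 0\<close> is chosen, the two moments determine its weight and the lower atom.
\<close>
definition two_point_law :: "real \<Rightarrow> real \<Rightarrow> real \<Rightarrow> real measure" where
  "two_point_law \<mu> \<sigma> h = measure_pmf (map_pmf (\<lambda>b. if b then \<mu> + h else \<mu> - \<sigma>\<^sup>2 / h)
     (bernoulli_pmf (\<sigma>\<^sup>2 / (\<sigma>\<^sup>2 + h\<^sup>2))))"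

context
  fixes \<mu> \<sigma> h :: real
  assumes \<sigma>: "\<sigma> > 0" and h: "h > 0"
begin

lemma two_point_law_weights: "0 < \<sigma>\<^sup>2 / (\<sigma>\<^sup>2 + h\<^sup>2)" "\<sigma>\<^sup>2 / (\<sigma>\<^sup>2 + h\<^sup>2) < 1"
  "1 - \<sigma>\<^sup>2 / (\<sigma>\<^sup>2 + h\<^sup>2) = h\<^sup>2 / (\<sigma>\<^sup>2 + h\<^sup>2)"
  using \<sigma> h by (auto simp: field_simps add_pos_pos)

lemma two_point_law_expectation:
  fixes g :: "real \<Rightarrow> real"
  shows "integrable (two_point_law \<mu> \<sigma> h) g"
    and "(LINT x|two_point_law \<mu> \<sigma> h. g x) =
      (\<sigma>\<^sup>2 * g (\<mu> + h) + h\<^sup>2 * g (\<mu> - \<sigma>\<^sup>2 / h)) / (\<sigma>\<^sup>2 + h\<^sup>2)"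
proof -
  show "integrable (two_point_law \<mu> \<sigma> h) g"
    unfolding two_point_law_def by (intro integrable_measure_pmf_finite) simp
  show "(LINT x|two_point_law \<mu> \<sigma> h. g x) =
      (\<sigma>\<^sup>2 * g (\<mu> + h) + h\<^sup>2 * g (\<mu> - \<sigma>\<^sup>2 / h)) / (\<sigma>\<^sup>2 + h\<^sup>2)"
    unfolding two_point_law_def integral_map_pmf using two_point_law_weights
    by (simp add: add_divide_distrib mult.commute)
qed

lemma two_point_law_moment_class: "(two_point_law \<mu> \<sigma> h, \<lambda>x. x) \<in> moment_class \<mu> \<sigma>"
proof -
  have nz: "\<sigma>\<^sup>2 + h\<^sup>2 \<noteq> 0" using \<sigma> h by (simp add: add_pos_pos less_imp_neq[symmetric])
  have 1: "(LINT x|two_point_law \<mu> \<sigma> h. x) = \<mu>"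
    unfolding two_point_law_expectation(2) using nz h by (simp add: field_simps power2_eq_square)
  have 2: "(LINT x|two_point_law \<mu> \<sigma> h. (x - \<mu>)\<^sup>2) = \<sigma>\<^sup>2"
    unfolding two_point_law_expectation(2) using nz h by (simp add: field_simps power2_eq_square)
  have "prob_space (two_point_law \<mu> \<sigma> h)"
    unfolding two_point_law_def by (rule measure_pmf.prob_space_axioms)
  moreover have "(\<lambda>x. x) \<in> borel_measurable (two_point_law \<mu> \<sigma> h)"
    unfolding two_point_law_def by simp
  ultimately show ?thesis
    unfolding moment_class_def by (simp add: two_point_law_expectation(1) 1 2)
qed

lemma AE_two_point_law: "AE x in two_point_law \<mu> \<sigma> h. x = \<mu> + h \<or> x = \<mu> - \<sigma>\<^sup>2 / h"
  unfolding two_point_law_def by (auto simp: AE_measure_pmf_iff)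

lemma measure_two_point_law:
  "measure (two_point_law \<mu> \<sigma> h) A =
     (\<sigma>\<^sup>2 * indicator A (\<mu> + h) + h\<^sup>2 * indicator A (\<mu> - \<sigma>\<^sup>2 / h)) / (\<sigma>\<^sup>2 + h\<^sup>2)"
  using two_point_law_expectation(2)[of "indicator A"] by (simp add: two_point_law_def)

lemma two_point_law_atoms_less: "\<mu> - \<sigma>\<^sup>2 / h < \<mu> + h"
proof -
  have "0 < \<sigma>\<^sup>2 / h" using \<sigma> h by simp
  with h show ?thesis by linarith
qed

lemma two_point_two_point_law: "two_point (two_point_law \<mu> \<sigma> h) (\<lambda>x. x)"
  unfolding two_point_def
proof (intro exI conjI)
  have s: "space (two_point_law \<mu> \<sigma> h) = UNIV" by (simp add: two_point_law_def)
  show "\<mu> + h \<noteq> \<mu> - \<sigma>\<^sup>2 / h" using two_point_law_atoms_less by simp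
  show "0 < measure (two_point_law \<mu> \<sigma> h) {x \<in> space (two_point_law \<mu> \<sigma> h). x = \<mu> + h}"
    using two_point_law_atoms_less \<sigma> h by (simp add: s measure_two_point_law add_pos_pos)
  show "0 < measure (two_point_law \<mu> \<sigma> h) {x \<in> space (two_point_law \<mu> \<sigma> h). x = \<mu> - \<sigma>\<^sup>2 / h}"
    using two_point_law_atoms_less \<sigma> h by (simp add: s measure_two_point_law add_pos_pos)
qed (rule AE_two_point_law)

lemma quantile_two_point_law:
  assumes "0 < u" "u < 1"
  shows "quantile (two_point_law \<mu> \<sigma> h) (\<lambda>x. x) u =
    (if u \<le> h\<^sup>2 / (\<sigma>\<^sup>2 + h\<^sup>2) then \<mu> - \<sigma>\<^sup>2 / h else \<mu> + h)"
proof -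
  have "cdf (distr (two_point_law \<mu> \<sigma> h) borel (\<lambda>x. x)) t =
      measure (two_point_law \<mu> \<sigma> h) {..t}" for t
    unfolding cdf_def by (subst measure_distr) (auto simp: two_point_law_def)
  then have *: "cdf (distr (two_point_law \<mu> \<sigma> h) borel (\<lambda>x. x)) t =
     (if t < \<mu> - \<sigma>\<^sup>2 / h then 0 else if t < \<mu> + h then h\<^sup>2 / (\<sigma>\<^sup>2 + h\<^sup>2) else 1)" for t
    using two_point_law_atoms_less \<sigma> h
    by (auto simp: measure_two_point_law add_pos_pos less_imp_neq[symmetric])
  have "{t. u \<le> cdf (distr (two_point_law \<mu> \<sigma> h) borel (\<lambda>x. x)) t} =
    {if u \<le> h\<^sup>2 / (\<sigma>\<^sup>2 + h\<^sup>2) then \<mu> - \<sigma>\<^sup>2 / h else \<mu> + h ..}"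
    using assms two_point_law_atoms_less by (auto simp: * split: if_splits)
  then show ?thesis unfolding quantile_def by simp
qed

text \<open>
  The quantile jumps from the lower to the upper atom at \<open>h\<^sup>2 / (\<sigma>\<^sup>2 + h\<^sup>2)\<close>, the weight of the
  lower one. When this weight is below \<open>\<alpha>\<close>, the tail sees the upper atom only; the maximum
  covers both situations.
\<close>

lemma distorted_utility_two_point_law:
  assumes U: "U \<in> borel_measurable borel" and \<alpha>: "0 < \<alpha>" "\<alpha> < 1"
  defines "v \<equiv> max \<alpha> (h\<^sup>2 / (\<sigma>\<^sup>2 + h\<^sup>2))"
  shows "distorted_utility U (es_distortion \<alpha>) (two_point_law \<mu> \<sigma> h) (\<lambda>x. x) =
    (U (\<mu> - \<sigma>\<^sup>2 / h) * (v - \<alpha>) + U (\<mu> + h) * (1 - v)) / (1 - \<alpha>)"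
proof -
  note m = moment_classD[OF two_point_law_moment_class]
  interpret O: prob_space unit_lborel by (rule prob_space_unit_lborel)
  let ?l = "U (\<mu> - \<sigma>\<^sup>2 / h)" and ?u = "U (\<mu> + h)"
  have v: "\<alpha> \<le> v" "0 \<le> v" "v \<le> 1" using \<alpha> two_point_law_weights unfolding v_def by auto
  have indi: "integrable unit_lborel (indicator {b<..} :: real \<Rightarrow> real)" for b
    by (rule O.integrable_const_bound[where B = 1]) auto
  have "(LINT u|unit_lborel. indicator {\<alpha><..} u * U (quantile (two_point_law \<mu> \<sigma> h) (\<lambda>x. x) u))
    = (LINT u|unit_lborel. ?l * indicator {\<alpha><..} u + (?u - ?l) * indicator {v<..} u)"
  proof (rule Bochner_Integration.integral_cong[OF refl])
    fix u assume "u \<in> space unit_lborel"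
    then have "0 < u" "u < 1" by (auto simp: space_restrict_space)
    then show "indicator {\<alpha><..} u * U (quantile (two_point_law \<mu> \<sigma> h) (\<lambda>x. x) u) =
      ?l * indicator {\<alpha><..} u + (?u - ?l) * indicator {v<..} u"
      by (auto simp: quantile_two_point_law v_def split: split_indicator)
  qed
  also have "\<dots> = ?l * (1 - \<alpha>) + (?u - ?l) * (1 - v)"
    using indi[of \<alpha>] indi[of v] integral_unit_lborel_indicator_greaterThan[of \<alpha>]
      integral_unit_lborel_indicator_greaterThan[of v] v \<alpha> by simp
  finally show ?thesis
    by (simp add: distorted_utility_es[OF m(1,2) U \<alpha>(2)] algebra_simps)
qed

end

section \<open>The uncapped utility\<close>

text \<open>
  For every kink position \<open>s \<ge> a\<close> the hinge at \<open>a\<close> is at most \<open>s - a\<close> plus the hinge at \<open>s\<close>.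
  With \<open>E = sqrt ((s - \<mu>)\<^sup>2 + \<sigma>\<^sup>2)\<close> the hinge at \<open>s\<close> lies below the parabola with vertex \<open>s - E\<close>
  that touches it at \<open>s \<plusminus> E\<close>, the atoms of the extremal two-point law. The hypothesis is an
  inequality for \<open>U\<close> so that the bound covers the capped utility as well.
\<close>

lemma distorted_utility_le_of_le_uncapped:
  assumes PX: "(P, X) \<in> moment_class \<mu> \<sigma>" and U: "U \<in> borel_measurable borel"
    and \<alpha>: "0 < \<alpha>" "\<alpha> < 1" and "\<sigma> > 0" "\<kappa> > 0" "a \<le> s"
    and le: "\<And>x. U x \<le> uncapped_utility \<kappa> a x"
  shows "distorted_utility U (es_distortion \<alpha>) P X \<le>
    \<kappa> * (s - a) + \<kappa> / (2 * (1 - \<alpha>)) * (sqrt ((s - \<mu>)\<^sup>2 + \<sigma>\<^sup>2) - (s - \<mu>))"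
proof -
  define E where "E = sqrt ((s - \<mu>)\<^sup>2 + \<sigma>\<^sup>2)"
  have E: "E > 0" "E\<^sup>2 = (s - \<mu>)\<^sup>2 + \<sigma>\<^sup>2"
    using \<open>\<sigma> > 0\<close> by (auto simp: E_def add_nonneg_pos)
  have maj: "max (x - s) 0 \<le> (x - (s - E))\<^sup>2 / (4 * E)" for x
  proof -
    have "4 * E * (x - s) \<le> (x - (s - E))\<^sup>2"
      using zero_le_power2[of "x - s - E"] by (simp add: power2_eq_square algebra_simps)
    then show ?thesis using E by (auto simp: field_simps max_def)
  qed
  have "distorted_utility U (es_distortion \<alpha>) P X \<le>
      \<kappa> * (s - a) + \<kappa> / (4 * E) * (\<sigma>\<^sup>2 + (\<mu> - (s - E))\<^sup>2) / (1 - \<alpha>)"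
  proof (rule distorted_utility_le_of_quadratic_majorant[OF PX U \<alpha>])
    fix x
    have "max (x - a) 0 \<le> (s - a) + max (x - s) 0" using \<open>a \<le> s\<close> by auto
    also have "\<dots> \<le> (s - a) + (x - (s - E))\<^sup>2 / (4 * E)" using maj by simp
    finally have "\<kappa> * max (x - a) 0 \<le> \<kappa> * ((s - a) + (x - (s - E))\<^sup>2 / (4 * E))"
      using \<open>\<kappa> > 0\<close> by (intro mult_left_mono) auto
    with le[of x] show "U x \<le> \<kappa> * (s - a) + \<kappa> / (4 * E) * (x - (s - E))\<^sup>2"
      by (simp add: uncapped_utility_def distrib_left)
  qed (use E assms in auto)
  also have "\<sigma>\<^sup>2 + (\<mu> - (s - E))\<^sup>2 = 2 * E * (E - (s - \<mu>))"
    using E(2) by (simp add: power2_eq_square algebra_simps)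
  also have "\<kappa> / (4 * E) * (2 * E * (E - (s - \<mu>))) / (1 - \<alpha>) = \<kappa> / (2 * (1 - \<alpha>)) * (E - (s - \<mu>))"
    using E \<alpha> by (simp add: field_simps)
  finally show ?thesis by (simp add: E_def)
qed

context
  fixes \<mu> \<sigma> \<alpha> :: real
  assumes \<sigma>: "\<sigma> > 0" and \<alpha>: "0 < \<alpha>" "\<alpha> < 1"
begin

lemma U_level_minus_mean: "U_level \<mu> \<sigma> \<alpha> - \<mu> > 0"
  "(U_level \<mu> \<sigma> \<alpha> - \<mu>)\<^sup>2 = \<sigma>\<^sup>2 * \<alpha> / (1 - \<alpha>)"
  using \<sigma> \<alpha> by (auto simp: U_level_def power_mult_distrib)

lemma U_level_minus_T_level:
  "U_level \<mu> \<sigma> \<alpha> - T_level \<mu> \<sigma> \<alpha> = \<sigma> / (2 * sqrt (\<alpha> * (1 - \<alpha>)))"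
proof -
  have "sqrt (\<alpha> / (1 - \<alpha>)) = \<alpha> / sqrt (\<alpha> * (1 - \<alpha>))"
  proof -
    have "\<alpha> / (1 - \<alpha>) = \<alpha>\<^sup>2 / (\<alpha> * (1 - \<alpha>))" using \<alpha> by (simp add: power2_eq_square)
    then show ?thesis using \<alpha> by (simp only: real_sqrt_divide) simp
  qed
  moreover define r where "r = sqrt (\<alpha> * (1 - \<alpha>))"
  moreover have "r \<noteq> 0" using \<alpha> by (simp add: r_def)
  ultimately show ?thesis
    unfolding U_level_def T_level_def by (simp add: r_def[symmetric] field_simps)
qed

text \<open>
  This is where \<open>T_level\<close> comes from: the kink whose extremal two-point law has the
  upper atom \<open>U_level\<close>, which is the atom of weight exactly \<open>1 - \<alpha>\<close>.
\<close>

lemma sqrt_T_level: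
  "sqrt ((T_level \<mu> \<sigma> \<alpha> - \<mu>)\<^sup>2 + \<sigma>\<^sup>2) = U_level \<mu> \<sigma> \<alpha> - T_level \<mu> \<sigma> \<alpha>"
proof (rule real_sqrt_unique)
  define r where "r = sqrt (\<alpha> * (1 - \<alpha>))"
  have r: "r > 0" "r\<^sup>2 = \<alpha> * (1 - \<alpha>)" using \<alpha> by (simp_all add: r_def)
  have "(\<sigma> * ((2 * \<alpha> - 1) / (2 * r)))\<^sup>2 + \<sigma>\<^sup>2 = \<sigma>\<^sup>2 * ((2 * \<alpha> - 1)\<^sup>2 + 4 * r\<^sup>2) / (4 * r\<^sup>2)"
    using r(1) by (simp add: field_simps power2_eq_square)
  also have "(2 * \<alpha> - 1)\<^sup>2 + 4 * r\<^sup>2 = 1"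
    by (simp add: r(2)) (simp add: power2_eq_square algebra_simps)
  finally have "(\<sigma> * ((2 * \<alpha> - 1) / (2 * r)))\<^sup>2 + \<sigma>\<^sup>2 = (\<sigma> / (2 * r))\<^sup>2"
    by (simp add: power_divide power_mult_distrib)
  moreover have "T_level \<mu> \<sigma> \<alpha> - \<mu> = \<sigma> * ((2 * \<alpha> - 1) / (2 * r))"
    by (simp add: T_level_def r_def)
  ultimately show "(U_level \<mu> \<sigma> \<alpha> - T_level \<mu> \<sigma> \<alpha>)\<^sup>2 = (T_level \<mu> \<sigma> \<alpha> - \<mu>)\<^sup>2 + \<sigma>\<^sup>2"
    by (simp add: U_level_minus_T_level r_def)
  show "0 \<le> U_level \<mu> \<sigma> \<alpha> - T_level \<mu> \<sigma> \<alpha>"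
    unfolding U_level_minus_T_level using \<sigma> \<alpha> by simp
qed

lemma T_level_balance:
  "U_level \<mu> \<sigma> \<alpha> + \<mu> - 2 * T_level \<mu> \<sigma> \<alpha> =
     2 * (1 - \<alpha>) * (U_level \<mu> \<sigma> \<alpha> - T_level \<mu> \<sigma> \<alpha>)"
proof -
  have "T_level \<mu> \<sigma> \<alpha> = \<mu> + (2 * \<alpha> - 1) * (U_level \<mu> \<sigma> \<alpha> - T_level \<mu> \<sigma> \<alpha>)"
    unfolding U_level_minus_T_level by (simp add: T_level_def)
  then show ?thesis by (simp add: algebra_simps)
qed

text \<open>
  The bound for a kink \<open>s \<ge> a\<close> is smallest at \<open>s = max a T\<close> with \<open>T\<close> the value of \<open>T_level\<close>,
  which explains the case distinction in \<open>S_value\<close>.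
\<close>

lemma distorted_utility_le_S_value:
  assumes "(P, X) \<in> moment_class \<mu> \<sigma>" "U \<in> borel_measurable borel" "\<kappa> > 0"
    "\<And>x. U x \<le> uncapped_utility \<kappa> a x"
  shows "distorted_utility U (es_distortion \<alpha>) P X \<le> S_value \<mu> \<sigma> \<kappa> \<alpha> a"
proof (cases "a \<le> T_level \<mu> \<sigma> \<alpha>")
  case True
  let ?T = "T_level \<mu> \<sigma> \<alpha>" and ?L = "U_level \<mu> \<sigma> \<alpha>"
  have "distorted_utility U (es_distortion \<alpha>) P X \<le>
      \<kappa> * (?T - a) + \<kappa> / (2 * (1 - \<alpha>)) * (sqrt ((?T - \<mu>)\<^sup>2 + \<sigma>\<^sup>2) - (?T - \<mu>))"
    using assms \<sigma> \<alpha> True by (intro distorted_utility_le_of_le_uncapped) auto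
  also have "sqrt ((?T - \<mu>)\<^sup>2 + \<sigma>\<^sup>2) - (?T - \<mu>) = 2 * (1 - \<alpha>) * (?L - ?T)"
    unfolding sqrt_T_level using T_level_balance by simp
  also have "\<kappa> * (?T - a) + \<kappa> / (2 * (1 - \<alpha>)) * (2 * (1 - \<alpha>) * (?L - ?T)) = \<kappa> * (?L - a)"
  proof -
    have "\<kappa> / (2 * (1 - \<alpha>)) * (2 * (1 - \<alpha>) * (?L - ?T)) = \<kappa> * (?L - ?T)" using \<alpha> by simp
    then show ?thesis by (simp only:) (simp add: algebra_simps)
  qed
  finally show ?thesis using True by (simp add: S_value_def)
next
  case False
  then show ?thesis
    using distorted_utility_le_of_le_uncapped[OF assms(1,2) \<alpha> \<sigma> assms(3) order_refl assms(4)]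
    by (simp add: S_value_def)
qed

lemma distorted_utility_two_point_law_U_level:
  assumes "U \<in> borel_measurable borel"
  shows "distorted_utility U (es_distortion \<alpha>) (two_point_law \<mu> \<sigma> (U_level \<mu> \<sigma> \<alpha> - \<mu>)) (\<lambda>x. x)
    = U (U_level \<mu> \<sigma> \<alpha>)"
proof -
  have "(U_level \<mu> \<sigma> \<alpha> - \<mu>)\<^sup>2 / (\<sigma>\<^sup>2 + (U_level \<mu> \<sigma> \<alpha> - \<mu>)\<^sup>2) = \<alpha>"
    unfolding U_level_minus_mean(2) using \<sigma> \<alpha>
    by (simp add: divide_simps add_pos_pos) (simp add: algebra_simps)
  then show ?thesis
    using \<alpha> by (simp add: distorted_utility_two_point_law[OF \<sigma> U_level_minus_mean(1) assms \<alpha>])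
qed

text \<open>
  An upper atom beyond \<open>U_level\<close> has weight at most \<open>1 - \<alpha>\<close>, so all of it lies in the tail. If
  the lower atom contributes nothing, the value is the expected utility divided by \<open>1 - \<alpha>\<close>.
\<close>

lemma distorted_utility_two_point_law_above_U_level:
  assumes "U \<in> borel_measurable borel" "U (\<mu> - \<sigma>\<^sup>2 / h) = 0" "U_level \<mu> \<sigma> \<alpha> \<le> \<mu> + h"
  shows "distorted_utility U (es_distortion \<alpha>) (two_point_law \<mu> \<sigma> h) (\<lambda>x. x)
    = U (\<mu> + h) * \<sigma>\<^sup>2 / ((1 - \<alpha>) * (\<sigma>\<^sup>2 + h\<^sup>2))"
proof -
  have h: "h > 0" using assms(3) U_level_minus_mean(1) by linarith
  have "\<sigma>\<^sup>2 * \<alpha> / (1 - \<alpha>) \<le> h\<^sup>2"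
    unfolding U_level_minus_mean(2)[symmetric] using assms(3) U_level_minus_mean(1)
    by (intro power_mono) auto
  then have "\<alpha> \<le> h\<^sup>2 / (\<sigma>\<^sup>2 + h\<^sup>2)"
    using \<alpha> \<sigma> h by (simp add: pos_le_divide_eq pos_divide_le_eq add_pos_pos algebra_simps)
  then have "distorted_utility U (es_distortion \<alpha>) (two_point_law \<mu> \<sigma> h) (\<lambda>x. x)
      = U (\<mu> + h) * (1 - h\<^sup>2 / (\<sigma>\<^sup>2 + h\<^sup>2)) / (1 - \<alpha>)"
    by (simp add: distorted_utility_two_point_law[OF \<sigma> h assms(1) \<alpha>] max_absorb2 assms(2))
  also have "1 - h\<^sup>2 / (\<sigma>\<^sup>2 + h\<^sup>2) = \<sigma>\<^sup>2 / (\<sigma>\<^sup>2 + h\<^sup>2)"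
    using two_point_law_weights(3)[OF \<sigma> h] by linarith
  finally show ?thesis by (simp add: mult.commute)
qed

text \<open>
  The optimal law concentrates at the contact points of the optimal majorant. Its value is
  unaffected by what the utility does away from \<open>(-\<infinity>, a]\<close> and the upper atom; hence the statement
  is made for all utilities that agree with the uncapped one there, and for the capped utility it
  remains to compare the position of the upper atom with the cap.
\<close>

lemma S_value_attained:
  obtains h where "h > 0" "a \<le> T_level \<mu> \<sigma> \<alpha> \<Longrightarrow> \<mu> + h = U_level \<mu> \<sigma> \<alpha>"
    "T_level \<mu> \<sigma> \<alpha> < a \<Longrightarrow> \<mu> + h = a + sqrt ((a - \<mu>)\<^sup>2 + \<sigma>\<^sup>2)"
    "\<And>U \<kappa>. U \<in> borel_measurable borel \<Longrightarrow> (\<And>x. x \<le> a \<Longrightarrow> U x = 0) \<Longrightarrow>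
       U (\<mu> + h) = uncapped_utility \<kappa> a (\<mu> + h) \<Longrightarrow>
       distorted_utility U (es_distortion \<alpha>) (two_point_law \<mu> \<sigma> h) (\<lambda>x. x) = S_value \<mu> \<sigma> \<kappa> \<alpha> a"
proof (cases "a \<le> T_level \<mu> \<sigma> \<alpha>")
  case True
  have "T_level \<mu> \<sigma> \<alpha> \<le> U_level \<mu> \<sigma> \<alpha>" 
  proof -
    have "0 \<le> U_level \<mu> \<sigma> \<alpha> - T_level \<mu> \<sigma> \<alpha>"
      unfolding U_level_minus_T_level using \<sigma> \<alpha> by simp
    then show ?thesis by simp
  qed
  with True show ?thesis
    using U_level_minus_mean(1)
    by (intro that[of "U_level \<mu> \<sigma> \<alpha> - \<mu>"])
      (auto simp: distorted_utility_two_point_law_U_level S_value_def uncapped_utility_def)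
next
  case False
  define D where "D = sqrt ((a - \<mu>)\<^sup>2 + \<sigma>\<^sup>2)"
  have D: "D > 0" "D\<^sup>2 = (a - \<mu>)\<^sup>2 + \<sigma>\<^sup>2" 
    using \<sigma> by (auto simp: D_def add_nonneg_pos)
  have D_gt: "\<bar>a - \<mu>\<bar> < D"
    unfolding D_def using \<sigma> by (intro real_less_rsqrt) simp
  define h where "h = a + D - \<mu>"
  have h: "h > 0" using D_gt by (simp add: h_def)
  define d where "d = a - \<mu>"
  have hd: "h = d + D" by (simp add: h_def d_def)
  have \<sigma>2: "\<sigma>\<^sup>2 = (D - d) * h"
    using D(2) by (simp add: hd d_def power2_eq_square algebra_simps)
  have low: "\<sigma>\<^sup>2 / h = D - d" using h by (simp add: \<sigma>2)
  have sum: "\<sigma>\<^sup>2 + h\<^sup>2 = 2 * D * h"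
    unfolding \<sigma>2 by (simp add: hd power2_eq_square algebra_simps)
  (* The upper contact point a + sqrt ((a - \<mu>)\<^sup>2 + \<sigma>\<^sup>2) increases with a, and at a = T_level it
     is U_level. *)
  have "U_level \<mu> \<sigma> \<alpha> \<le> \<mu> + h"
  proof -
    let ?t = "T_level \<mu> \<sigma> \<alpha> - \<mu>"
    have "(U_level \<mu> \<sigma> \<alpha> - T_level \<mu> \<sigma> \<alpha>) - D \<le> a - T_level \<mu> \<sigma> \<alpha>"
    proof (cases "D \<le> U_level \<mu> \<sigma> \<alpha> - T_level \<mu> \<sigma> \<alpha>")
      case True
      let ?E = "U_level \<mu> \<sigma> \<alpha> - T_level \<mu> \<sigma> \<alpha>"
      have E2: "?E\<^sup>2 = ?t\<^sup>2 + \<sigma>\<^sup>2" unfolding sqrt_T_level[symmetric] by simp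
      have "\<bar>?t\<bar> < ?E" unfolding sqrt_T_level[symmetric] using \<sigma> by (intro real_less_rsqrt) simp
      have "(?E - D) * (?E + D) = (?t - d) * (?t + d)"
        using E2 D(2) by (simp add: d_def power2_eq_square algebra_simps)
      also have "\<dots> \<le> (d - ?t) * (?E + D)"
      proof -
        have "- (?t + d) \<le> ?E + D" using \<open>\<bar>?t\<bar> < ?E\<close> D_gt by (simp add: d_def)
        moreover have "0 \<le> d - ?t" using False by (simp add: d_def)
        ultimately have "(d - ?t) * - (?t + d) \<le> (d - ?t) * (?E + D)" by (rule mult_left_mono)
        then show ?thesis by (simp add: algebra_simps)
      qed
      finally have "?E - D \<le> d - ?t"
        using True D(1) by (simp add: mult_le_cancel_right)
      then show ?thesis by (simp add: d_def)
    qed (use False in auto)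
    then show ?thesis by (simp add: h_def)
  qed
  note weight_value = distorted_utility_two_point_law_above_U_level[OF _ _ this]
  show ?thesis
  proof (rule that[of h])
    fix U :: "real \<Rightarrow> real" and \<kappa>
    assume U: "U \<in> borel_measurable borel" "\<And>x. x \<le> a \<Longrightarrow> U x = 0"
      "U (\<mu> + h) = uncapped_utility \<kappa> a (\<mu> + h)"
    have "U (\<mu> - \<sigma>\<^sup>2 / h) = 0"
      using D by (intro U(2)) (simp add: low d_def)
    then have "distorted_utility U (es_distortion \<alpha>) (two_point_law \<mu> \<sigma> h) (\<lambda>x. x)
      = U (\<mu> + h) * \<sigma>\<^sup>2 / ((1 - \<alpha>) * (\<sigma>\<^sup>2 + h\<^sup>2))" by (rule weight_value[OF U(1)])
    also have "U (\<mu> + h) = \<kappa> * D" using D unfolding U(3) uncapped_utility_def by (simp add: h_def)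
    also have "\<kappa> * D * \<sigma>\<^sup>2 / ((1 - \<alpha>) * (\<sigma>\<^sup>2 + h\<^sup>2)) = \<kappa> / (2 * (1 - \<alpha>)) * (D - d)"
    proof -
      have "\<kappa> * D * \<sigma>\<^sup>2 / ((1 - \<alpha>) * (2 * D * h)) = D * (\<kappa> * \<sigma>\<^sup>2) / (D * (2 * (1 - \<alpha>) * h))"
        by (simp only: mult_ac)
      also have "\<dots> = \<kappa> / (2 * (1 - \<alpha>)) * (\<sigma>\<^sup>2 / h)" using D(1) by simp
      finally show ?thesis unfolding sum low .
    qed
    also have "\<dots> = S_value \<mu> \<sigma> \<kappa> \<alpha> a" using False by (simp add: S_value_def D_def d_def)
    finally show "distorted_utility U (es_distortion \<alpha>) (two_point_law \<mu> \<sigma> h) (\<lambda>x. x) = S_value \<mu> \<sigma> \<kappa> \<alpha> a" .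
  qed (use h False in \<open>simp_all add: h_def D_def\<close>)
qed

end

section \<open>The largest value\<close>

lemma uncapped_utility_measurable [measurable]: "uncapped_utility \<kappa> a \<in> borel_measurable borel"
  unfolding uncapped_utility_def[abs_def] by measurable

lemma capped_utility_measurable [measurable]: "capped_utility \<kappa> a B \<in> borel_measurable borel"
  unfolding capped_utility_def[abs_def] by measurable

lemma capped_utility_le: "capped_utility \<kappa> a B x \<le> uncapped_utility \<kappa> a x" "capped_utility \<kappa> a B x \<le> B"
  by (auto simp: capped_utility_def uncapped_utility_def)

lemma capped_utility_nonneg: "\<kappa> > 0 \<Longrightarrow> B > 0 \<Longrightarrow> 0 \<le> capped_utility \<kappa> a B x"
  by (simp add: capped_utility_def)

lemma mono_capped_utility: "\<kappa> > 0 \<Longrightarrow> mono (capped_utility \<kappa> a B)"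
  unfolding capped_utility_def mono_def
  by (intro allI impI min.mono mult_left_mono max.mono) auto

lemma capped_utility_eq_0: "B > 0 \<Longrightarrow> x \<le> a \<Longrightarrow> capped_utility \<kappa> a B x = 0"
  by (simp add: capped_utility_def)

lemma capped_utility_eq_cap:
  assumes "\<kappa> > 0" "B > 0" "a + B / \<kappa> \<le> x"
  shows "capped_utility \<kappa> a B x = B"
proof -
  have "B \<le> \<kappa> * (x - a)" using assms by (simp add: field_simps)
  also have "\<dots> \<le> \<kappa> * max (x - a) 0" using assms by simp
  finally show ?thesis by (simp add: capped_utility_def)
qed

lemma capped_utility_eq_uncapped:
  assumes "\<kappa> > 0" "B > 0" "x \<le> a + B / \<kappa>"
  shows "capped_utility \<kappa> a B x = uncapped_utility \<kappa> a x"
proof -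
  have "max (x - a) 0 \<le> B / \<kappa>" using assms by auto
  then have "\<kappa> * max (x - a) 0 \<le> \<kappa> * (B / \<kappa>)" using assms by (intro mult_left_mono) auto
  then have "\<kappa> * max (x - a) 0 \<le> B" using assms by simp
  then show ?thesis by (simp add: capped_utility_def uncapped_utility_def)
qed

lemma integrable_capped_utility:
  assumes "prob_space P" "X \<in> borel_measurable P" "\<kappa> > 0" "B > 0"
  shows "integrable P (\<lambda>\<omega>. capped_utility \<kappa> a B (X \<omega>))"
proof -
  interpret prob_space P by fact
  have [measurable]: "X \<in> borel_measurable P" by fact
  show ?thesis
    using capped_utility_le(2) capped_utility_nonneg[OF assms(3,4)]
    by (intro integrable_const_bound[where B = B]) auto
qed

text \<open>
  The parabola has its vertex at the lower atom \<open>\<mu> - \<sigma>\<^sup>2 / m\<close> and takes the value \<open>B\<close> at the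
  point \<open>\<mu> + m\<close> where the cap is reached. Beyond this point it exceeds the cap. Before it, convexity keeps the
  parabola above the rising part as soon as its slope there is at most \<open>\<kappa>\<close>, that is, as soon as the two
  atoms are at least \<open>2 * B / \<kappa>\<close> apart; the hypothesis on the square root says exactly this.
\<close>

lemma capped_utility_le_tangent_parabola:
  fixes \<mu> \<sigma> a \<kappa> B :: real
  assumes "\<sigma> > 0" "\<kappa> > 0" "B > 0"
    and m: "m > 0" "a + B / \<kappa> = \<mu> + m" and D: "B / \<kappa> \<le> sqrt ((a - \<mu>)\<^sup>2 + \<sigma>\<^sup>2)"
  shows "capped_utility \<kappa> a B x \<le> B / (m + \<sigma>\<^sup>2 / m)\<^sup>2 * (x - (\<mu> - \<sigma>\<^sup>2 / m))\<^sup>2"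
proof -
  define b where "b = B / \<kappa>"
  define w where "w = m + \<sigma>\<^sup>2 / m"
  define y where "y = x - (\<mu> + m)"
  have b: "b > 0" "B = \<kappa> * b" using assms by (auto simp: b_def)
  have w: "w > 0" using assms by (simp add: w_def add_pos_pos)
  have "b\<^sup>2 \<le> (a - \<mu>)\<^sup>2 + \<sigma>\<^sup>2" using D b(1) by (intro sqrt_ge_absD) (simp add: b_def[symmetric])
  moreover have "a - \<mu> = m - b" using m by (simp add: b_def)
  ultimately have "2 * b * m \<le> m\<^sup>2 + \<sigma>\<^sup>2" by (simp add: power2_eq_square algebra_simps)
  then have bw: "2 * b \<le> w"
    using m by (simp add: w_def field_simps power2_eq_square)
  have Q: "B / (m + \<sigma>\<^sup>2 / m)\<^sup>2 * (x - (\<mu> - \<sigma>\<^sup>2 / m))\<^sup>2 = B * (1 + y / w)\<^sup>2"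
  proof -
    have "x - (\<mu> - \<sigma>\<^sup>2 / m) = w * (1 + y / w)" using w by (simp add: distrib_left) (simp add: w_def y_def)
    then show ?thesis using w by (simp add: w_def[symmetric] power_mult_distrib)
  qed
  show ?thesis
  proof (cases "y \<ge> 0")
    case True
    then have "1 \<le> (1 + y / w)\<^sup>2" using w by (intro one_le_power) simp
    then have "B \<le> B * (1 + y / w)\<^sup>2" using \<open>B > 0\<close> by simp
    with capped_utility_le(2)[of \<kappa> a B x] show ?thesis unfolding Q by linarith
  next
    case False
    (* In the coordinate y = x - (\<mu> + m) the tangent at y = 0 is B * (1 + 2 * y / w), and
       2 * b \<le> w says that it is no steeper than the rising part. *)
    have "\<kappa> * (x - a) \<le> B * (1 + y / w)\<^sup>2"
    proof -
      have "y \<le> 2 * b * (y / w)"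
        using bw w False by (simp add: field_simps mult_left_mono_neg)
      then have "b + y \<le> b + 2 * b * (y / w) + b * (y / w)\<^sup>2" 
        using b by (simp add: add_increasing2)
      also have "\<dots> = b * (1 + y / w)\<^sup>2" by (simp add: power2_eq_square algebra_simps)
      finally have "\<kappa> * (b + y) \<le> \<kappa> * (b * (1 + y / w)\<^sup>2)" using \<open>\<kappa> > 0\<close> by simp
      moreover have "b + y = x - a" using m by (simp add: b_def y_def)
      ultimately show ?thesis by (simp add: b)
    qed
    moreover have "0 \<le> B * (1 + y / w)\<^sup>2" using \<open>B > 0\<close> by simp
    ultimately have "\<kappa> * max (x - a) 0 \<le> B * (1 + y / w)\<^sup>2" by (auto simp: max_def)
    then show ?thesis unfolding Q by (simp add: capped_utility_def)
  qed
qed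

lemma Psi_max_eqI:
  assumes "\<sigma> > 0" "h > 0"
    and "\<And>(P :: real measure) X. (P, X) \<in> moment_class \<mu> \<sigma> \<Longrightarrow> distorted_utility U \<phi> P X \<le> v"
    and "distorted_utility U \<phi> (two_point_law \<mu> \<sigma> h) (\<lambda>x. x) = v"
  shows "Psi_max U \<phi> \<mu> \<sigma> = ereal v"
    and "\<exists>(P :: real measure) X. (P, X) \<in> moment_class \<mu> \<sigma> \<and> two_point P X
          \<and> ereal (distorted_utility U \<phi> P X) = Psi_max U \<phi> \<mu> \<sigma>"
proof -
  show eq: "Psi_max U \<phi> \<mu> \<sigma> = ereal v"
    unfolding Psi_max_def
  proof (rule antisym)
    show "ereal v \<le> (SUP (P :: real measure, X)\<in>moment_class \<mu> \<sigma>. ereal (distorted_utility U \<phi> P X))"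
      using assms(4) two_point_law_moment_class[OF assms(1,2), of \<mu>]
      by (intro SUP_upper2[of "(two_point_law \<mu> \<sigma> h, \<lambda>x. x)"]) auto
  qed (use assms(3) in \<open>auto intro!: SUP_least\<close>)
  show "\<exists>(P :: real measure) X. (P, X) \<in> moment_class \<mu> \<sigma> \<and> two_point P X
          \<and> ereal (distorted_utility U \<phi> P X) = Psi_max U \<phi> \<mu> \<sigma>"
    unfolding eq using assms two_point_law_moment_class[OF assms(1,2), of \<mu>]
      two_point_two_point_law[OF assms(1,2), of \<mu>]
    by blast
qed

lemma Psi_max_uncapped:
  assumes "\<sigma> > 0" "\<kappa> > 0" "0 < \<alpha>" "\<alpha> < 1"
  shows "Psi_max (uncapped_utility \<kappa> a) (es_distortion \<alpha>) \<mu> \<sigma> = ereal (S_value \<mu> \<sigma> \<kappa> \<alpha> a)"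
proof -
  obtain h where h: "h > 0" "\<And>U \<kappa>. U \<in> borel_measurable borel \<Longrightarrow> (\<And>x. x \<le> a \<Longrightarrow> U x = 0) \<Longrightarrow>
       U (\<mu> + h) = uncapped_utility \<kappa> a (\<mu> + h) \<Longrightarrow>
       distorted_utility U (es_distortion \<alpha>) (two_point_law \<mu> \<sigma> h) (\<lambda>x. x) = S_value \<mu> \<sigma> \<kappa> \<alpha> a"
    using S_value_attained[OF assms(1,3,4), of a] by metis
  show ?thesis
  proof (rule Psi_max_eqI(1)[OF assms(1) h(1)])
    show "distorted_utility (uncapped_utility \<kappa> a) (es_distortion \<alpha>) (two_point_law \<mu> \<sigma> h) (\<lambda>x. x)
      = S_value \<mu> \<sigma> \<kappa> \<alpha> a"
      by (rule h(2)) (auto simp: uncapped_utility_def)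
  qed (use assms in \<open>auto intro!: distorted_utility_le_S_value\<close>)
qed

text \<open>
  Three majorants compete: the constant \<open>B\<close>, which is attained when the tail atom \<open>U_level\<close> already
  reaches the cap; the parabola touching at the point where the cap is reached; and the majorant
  for the uncapped utility, whose upper contact point then lies below the cap.
\<close>

lemma Psi_max_capped:
  fixes \<mu> \<sigma> a \<kappa> B \<alpha> :: real
  assumes "\<sigma> > 0" "\<kappa> > 0" "B > 0" "0 < \<alpha>" "\<alpha> < 1"
  defines "v \<equiv> if a + B / \<kappa> \<le> U_level \<mu> \<sigma> \<alpha> then B
       else if sqrt ((a - \<mu>)\<^sup>2 + \<sigma>\<^sup>2) \<ge> B / \<kappa>
         then B * \<sigma>\<^sup>2 / ((1 - \<alpha>) * (\<sigma>\<^sup>2 + (a + B / \<kappa> - \<mu>)\<^sup>2))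
       else S_value \<mu> \<sigma> \<kappa> \<alpha> a"
    and "U \<equiv> capped_utility \<kappa> a B"
  shows "Psi_max U (es_distortion \<alpha>) \<mu> \<sigma> = ereal v"
    and "\<exists>(P :: real measure) X. (P, X) \<in> moment_class \<mu> \<sigma> \<and> two_point P X
          \<and> ereal (distorted_utility U (es_distortion \<alpha>) P X) = Psi_max U (es_distortion \<alpha>) \<mu> \<sigma>"
proof -
  have Um: "U \<in> borel_measurable borel" by (simp add: U_def)
  note level = U_level_minus_mean[OF assms(1,4,5), of \<mu>]
  have "\<exists>h>0. distorted_utility U (es_distortion \<alpha>) (two_point_law \<mu> \<sigma> h) (\<lambda>x. x) = v \<and>
     (\<forall>(P :: real measure) X. (P, X) \<in> moment_class \<mu> \<sigma> \<longrightarrow>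
        distorted_utility U (es_distortion \<alpha>) P X \<le> v)"
  proof -
    consider (cap) "a + B / \<kappa> \<le> U_level \<mu> \<sigma> \<alpha>"
      | (parabola) "U_level \<mu> \<sigma> \<alpha> < a + B / \<kappa>" "B / \<kappa> \<le> sqrt ((a - \<mu>)\<^sup>2 + \<sigma>\<^sup>2)"
      | (uncapped) "U_level \<mu> \<sigma> \<alpha> < a + B / \<kappa>" "sqrt ((a - \<mu>)\<^sup>2 + \<sigma>\<^sup>2) < B / \<kappa>"
      by linarith
    then show ?thesis
    proof cases
      case cap
      then have "v = B" by (simp add: v_def)
      moreover have "distorted_utility U (es_distortion \<alpha>) P X \<le> B"
        if "(P, X) \<in> moment_class \<mu> \<sigma>" for P :: "real measure" and X
        using distorted_utility_le_of_quadratic_majorant[OF that Um assms(4,5), of B 0 0] assms(3)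
          capped_utility_le(2) by (simp add: U_def)
      moreover have "U (U_level \<mu> \<sigma> \<alpha>) = B"
        unfolding U_def using cap assms by (intro capped_utility_eq_cap)
      ultimately show ?thesis
        using level(1) distorted_utility_two_point_law_U_level[OF assms(1,4,5) Um]
        by (intro exI[of _ "U_level \<mu> \<sigma> \<alpha> - \<mu>"]) auto
    next
      case parabola
      define m where "m = a + B / \<kappa> - \<mu>"
      have m: "m > 0" "a + B / \<kappa> = \<mu> + m" using level(1) parabola by (auto simp: m_def)
      have v: "v = B * \<sigma>\<^sup>2 / ((1 - \<alpha>) * (\<sigma>\<^sup>2 + m\<^sup>2))" using parabola by (simp add: v_def m_def)
      have maj: "U x \<le> 0 + B / (m + \<sigma>\<^sup>2 / m)\<^sup>2 * (x - (\<mu> - \<sigma>\<^sup>2 / m))\<^sup>2" for x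
        unfolding U_def using capped_utility_le_tangent_parabola[OF assms(1-3) m parabola(2)] by simp
      have "U (\<mu> - \<sigma>\<^sup>2 / m) = 0"
        using maj[of "\<mu> - \<sigma>\<^sup>2 / m"] capped_utility_nonneg[OF assms(2,3), of a "\<mu> - \<sigma>\<^sup>2 / m"]
        by (simp add: U_def)
      moreover have "U (\<mu> + m) = B"
        unfolding U_def using m assms by (intro capped_utility_eq_cap) auto
      ultimately have "distorted_utility U (es_distortion \<alpha>) (two_point_law \<mu> \<sigma> m) (\<lambda>x. x) = v"
        using distorted_utility_two_point_law_above_U_level[OF assms(1,4,5) Um] parabola m v by simp
      moreover have "distorted_utility U (es_distortion \<alpha>) P X \<le> v"
        if "(P, X) \<in> moment_class \<mu> \<sigma>" for P :: "real measure" and X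
      proof -
        have "distorted_utility U (es_distortion \<alpha>) P X \<le>
            0 + B / (m + \<sigma>\<^sup>2 / m)\<^sup>2 * (\<sigma>\<^sup>2 + (\<mu> - (\<mu> - \<sigma>\<^sup>2 / m))\<^sup>2) / (1 - \<alpha>)"
          by (rule distorted_utility_le_of_quadratic_majorant[OF that Um assms(4,5) _ _ maj])
            (use assms in auto)
        also have "\<dots> = B * ((\<sigma>\<^sup>2 + (\<sigma>\<^sup>2 / m)\<^sup>2) / (m + \<sigma>\<^sup>2 / m)\<^sup>2) / (1 - \<alpha>)" by simp
        also have "(\<sigma>\<^sup>2 + (\<sigma>\<^sup>2 / m)\<^sup>2) / (m + \<sigma>\<^sup>2 / m)\<^sup>2 = \<sigma>\<^sup>2 / (\<sigma>\<^sup>2 + m\<^sup>2)"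
        proof -
          have "\<sigma>\<^sup>2 + (\<sigma>\<^sup>2 / m)\<^sup>2 = \<sigma>\<^sup>2 * (\<sigma>\<^sup>2 + m\<^sup>2) / m\<^sup>2" "m + \<sigma>\<^sup>2 / m = (\<sigma>\<^sup>2 + m\<^sup>2) / m"
            using m by (simp_all add: field_simps power2_eq_square)
          then show ?thesis using m \<open>\<sigma> > 0\<close> by (simp add: power_divide power2_eq_square[of "\<sigma>\<^sup>2 + m\<^sup>2"])
        qed
        finally show ?thesis by (simp add: v mult.commute)
      qed
      ultimately show ?thesis using m by blast
    next
      case uncapped
      then have v: "v = S_value \<mu> \<sigma> \<kappa> \<alpha> a" by (simp add: v_def)
      obtain h where h: "h > 0" "a \<le> T_level \<mu> \<sigma> \<alpha> \<Longrightarrow> \<mu> + h = U_level \<mu> \<sigma> \<alpha>"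
          "T_level \<mu> \<sigma> \<alpha> < a \<Longrightarrow> \<mu> + h = a + sqrt ((a - \<mu>)\<^sup>2 + \<sigma>\<^sup>2)"
        and S_value: "\<And>U \<kappa>. U \<in> borel_measurable borel \<Longrightarrow> (\<And>x. x \<le> a \<Longrightarrow> U x = 0) \<Longrightarrow>
          U (\<mu> + h) = uncapped_utility \<kappa> a (\<mu> + h) \<Longrightarrow>
          distorted_utility U (es_distortion \<alpha>) (two_point_law \<mu> \<sigma> h) (\<lambda>x. x) = S_value \<mu> \<sigma> \<kappa> \<alpha> a"
        using S_value_attained[OF assms(1,4,5), of a] by metis
      have "\<mu> + h \<le> a + B / \<kappa>" using h uncapped by (cases "a \<le> T_level \<mu> \<sigma> \<alpha>") auto
      then have "distorted_utility U (es_distortion \<alpha>) (two_point_law \<mu> \<sigma> h) (\<lambda>x. x) = v"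
        unfolding v U_def using assms
        by (intro S_value) (auto simp: capped_utility_eq_0 capped_utility_eq_uncapped)
      moreover have "distorted_utility U (es_distortion \<alpha>) P X \<le> v"
        if "(P, X) \<in> moment_class \<mu> \<sigma>" for P :: "real measure" and X
        unfolding v U_def using assms that capped_utility_le(1)
        by (intro distorted_utility_le_S_value) auto
      ultimately show ?thesis using h by blast
    qed
  qed
  then obtain h where "h > 0" "distorted_utility U (es_distortion \<alpha>) (two_point_law \<mu> \<sigma> h) (\<lambda>x. x) = v"
     "\<And>(P :: real measure) X. (P, X) \<in> moment_class \<mu> \<sigma> \<Longrightarrow>
        distorted_utility U (es_distortion \<alpha>) P X \<le> v" by blast
  note * = Psi_max_eqI[OF assms(1) this(1,3,2)]
  show "Psi_max U (es_distortion \<alpha>) \<mu> \<sigma> = ereal v" by (rule *(1))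
  show "\<exists>(P :: real measure) X. (P, X) \<in> moment_class \<mu> \<sigma> \<and> two_point P X
          \<and> ereal (distorted_utility U (es_distortion \<alpha>) P X) = Psi_max U (es_distortion \<alpha>) \<mu> \<sigma>"
    by (rule *(2))
qed

section \<open>The smallest value\<close>

lemma Psi_min_greatest:
  assumes "\<And>(P :: real measure) X. (P, X) \<in> moment_class \<mu> \<sigma> \<Longrightarrow> c \<le> distorted_utility U \<phi> P X"
  shows "ereal c \<le> Psi_min U \<phi> \<mu> \<sigma>"
  unfolding Psi_min_def using assms by (auto intro!: INF_greatest)

lemma Psi_min_le: "(P :: real measure, X) \<in> moment_class \<mu> \<sigma> \<Longrightarrow> Psi_min U \<phi> \<mu> \<sigma> \<le> ereal (distorted_utility U \<phi> P X)"
  unfolding Psi_min_def by (intro INF_lower2[of "(P, X)"]) auto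

context
  fixes \<mu> \<sigma> a \<kappa> B \<alpha> :: real
  assumes \<sigma>: "\<sigma> > 0" and \<kappa>: "\<kappa> > 0" and B: "B > 0" and \<alpha>: "0 < \<alpha>" "\<alpha> < 1"
begin

lemma expectation_le_distorted_utility_capped:
  assumes "(P, X) \<in> moment_class \<mu> \<sigma>"
  shows "(LINT \<omega>|P. capped_utility \<kappa> a B (X \<omega>)) \<le>
     distorted_utility (capped_utility \<kappa> a B) (es_distortion \<alpha>) P X"
  using moment_classD[OF assms] \<kappa> B \<alpha>
  by (intro expectation_le_distorted_utility mono_capped_utility integrable_capped_utility) auto

lemma Psi_min_capped_nonneg: "0 \<le> Psi_min (capped_utility \<kappa> a B) \<phi> \<mu> \<sigma>"
  unfolding zero_ereal_def
  by (intro Psi_min_greatest distorted_utility_nonneg capped_utility_nonneg \<kappa> B)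

text \<open>
  The value \<open>0\<close> would force the expected utility to vanish and hence \<open>X \<le> a \<le> \<mu>\<close> almost surely. A
  random variable bounded above by its own mean is constant, which contradicts \<open>\<sigma> > 0\<close>.
\<close>

lemma distorted_utility_pos_of_threshold_le_mean:
  assumes PX: "(P, X) \<in> moment_class \<mu> \<sigma>" and "a \<le> \<mu>"
  shows "0 < distorted_utility (capped_utility \<kappa> a B) (es_distortion \<alpha>) P X"
proof (rule ccontr)
  note m = moment_classD[OF PX]
  interpret prob_space P by (rule m)
  have [measurable]: "X \<in> borel_measurable P" by (rule m)
  note nn = capped_utility_nonneg[OF \<kappa> B]
  assume "\<not> ?thesis"
  moreover have "0 \<le> (LINT \<omega>|P. capped_utility \<kappa> a B (X \<omega>))"
    by (intro Bochner_Integration.integral_nonneg nn)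
  ultimately have "(LINT \<omega>|P. capped_utility \<kappa> a B (X \<omega>)) = 0"
    using expectation_le_distorted_utility_capped[OF PX] by linarith
  then have "AE \<omega> in P. capped_utility \<kappa> a B (X \<omega>) = 0"
    using integral_nonneg_eq_0_iff_AE[OF integrable_capped_utility[OF m(1,2) \<kappa> B]] nn by simp
  then have le: "AE \<omega> in P. X \<omega> \<le> \<mu>"
  proof eventually_elim
    case (elim \<omega>)
    then have "X \<omega> \<le> a" using \<kappa> B
      by (auto simp: capped_utility_def min_def max_def split: if_splits)
    with \<open>a \<le> \<mu>\<close> show ?case by simp
  qed
  have "(LINT \<omega>|P. \<mu> - X \<omega>) = 0" using m by (simp add: prob_space)
  then have "AE \<omega> in P. \<mu> - X \<omega> = 0"
    using integral_nonneg_eq_0_iff_AE[of P "\<lambda>\<omega>. \<mu> - X \<omega>"] le m by simp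
  then have "AE \<omega> in P. (X \<omega> - \<mu>)\<^sup>2 = 0" by eventually_elim simp
  then have "(LINT \<omega>|P. (X \<omega> - \<mu>)\<^sup>2) = 0"
    using integral_cong_AE[of "\<lambda>\<omega>. (X \<omega> - \<mu>)\<^sup>2" P "\<lambda>_. 0"] by simp
  with moment_class_square_distance(2)[OF PX, of \<mu>] \<sigma> show False by simp
qed

text \<open>
  A concave quadratic minorant in the spirit of the Paley-Zygmund inequality: the factor
  \<open>2 * s * (y - d) - s\<^sup>2 * y\<^sup>2\<close> with \<open>y = x - a\<close> lies below the indicator of \<open>y \<ge> d\<close>. Its expectation
  depends on the two moments only, so it gives a lower bound that is uniform over the moment class.
\<close>

lemma capped_utility_ge_parabola:
  assumes "d > 0" "s \<ge> 0"
  shows "capped_utility \<kappa> a B (a + d) * (2 * s * (x - a - d) - s\<^sup>2 * (x - a)\<^sup>2) \<le> capped_utility \<kappa> a B x"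
proof -
  define y where "y = x - a"
  have le1: "2 * s * (y - d) - s\<^sup>2 * y\<^sup>2 \<le> 1"
  proof -
    have "1 - (2 * s * (y - d) - s\<^sup>2 * y\<^sup>2) = (1 - s * y)\<^sup>2 + 2 * s * d"
      by (simp add: power2_eq_square algebra_simps)
    also have "0 \<le> \<dots>" using assms by simp
    finally show ?thesis by simp
  qed
  note nn = capped_utility_nonneg[OF \<kappa> B]
  show ?thesis
  proof (cases "d \<le> y")
    case True
    have "capped_utility \<kappa> a B (a + d) * (2 * s * (y - d) - s\<^sup>2 * y\<^sup>2) \<le> capped_utility \<kappa> a B (a + d)"
      using mult_left_mono[OF le1 nn[of a "a + d"]] by simp
    also have "\<dots> \<le> capped_utility \<kappa> a B x"
      using monoD[OF mono_capped_utility[OF \<kappa>], of "a + d" x] True by (simp add: y_def)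
    finally show ?thesis by (simp add: y_def)
  next
    case False
    then have "2 * s * (y - d) - s\<^sup>2 * y\<^sup>2 \<le> 0"
      using assms mult_nonneg_nonpos[of s "y - d"] zero_le_power2[of "s * y"]
      unfolding power_mult_distrib by linarith
    then have "capped_utility \<kappa> a B (a + d) * (2 * s * (y - d) - s\<^sup>2 * y\<^sup>2) \<le> 0"
      using nn by (intro mult_nonneg_nonpos)
    with nn[of a x] show ?thesis by (simp add: y_def)
  qed
qed

lemma Psi_min_capped_threshold_below_mean:
  assumes "a < \<mu>"
  shows "0 < Psi_min (capped_utility \<kappa> a B) (es_distortion \<alpha>) \<mu> \<sigma>"
proof -
  define m where "m = \<mu> - a"
  define N where "N = \<sigma>\<^sup>2 + m\<^sup>2"
  (* With d = m / 2 the expected minorant is proportional to s * m - s\<^sup>2 * N; this s maximises it. *)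
  define s where "s = m / (2 * N)"
  define w where "w = capped_utility \<kappa> a B (a + m / 2)"
  have pos: "m > 0" "N > 0" "s > 0" "w > 0"
    using assms \<sigma> \<kappa> B by (auto simp: m_def N_def s_def w_def capped_utility_def add_pos_nonneg)
  have "ereal (w * (m\<^sup>2 / (4 * N))) \<le> Psi_min (capped_utility \<kappa> a B) (es_distortion \<alpha>) \<mu> \<sigma>"
  proof (rule Psi_min_greatest)
    fix P :: "real measure" and X assume PX: "(P, X) \<in> moment_class \<mu> \<sigma>"
    note mc = moment_classD[OF PX]
    interpret prob_space P by (rule mc)
    note sq = moment_class_square_distance[OF PX, of a]
    have "w * (m\<^sup>2 / (4 * N)) = w * (2 * s * (m - m / 2) - s\<^sup>2 * N)"
      using pos by (simp add: s_def power2_eq_square field_simps)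
    also have "\<dots> = (LINT \<omega>|P. w * (2 * s * (X \<omega> - a - m / 2) - s\<^sup>2 * (X \<omega> - a)\<^sup>2))"
      using mc sq by (simp add: prob_space m_def N_def)
    also have "\<dots> \<le> (LINT \<omega>|P. capped_utility \<kappa> a B (X \<omega>))"
    proof (rule integral_mono)
      show "integrable P (\<lambda>\<omega>. w * (2 * s * (X \<omega> - a - m / 2) - s\<^sup>2 * (X \<omega> - a)\<^sup>2))"
        using mc sq by simp
      show "integrable P (\<lambda>\<omega>. capped_utility \<kappa> a B (X \<omega>))"
        by (rule integrable_capped_utility[OF mc(1,2) \<kappa> B])
      show "w * (2 * s * (X \<omega> - a - m / 2) - s\<^sup>2 * (X \<omega> - a)\<^sup>2) \<le> capped_utility \<kappa> a B (X \<omega>)" for \<omega>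
        unfolding w_def using pos by (intro capped_utility_ge_parabola) auto
    qed
    also have "\<dots> \<le> distorted_utility (capped_utility \<kappa> a B) (es_distortion \<alpha>) P X"
      by (rule expectation_le_distorted_utility_capped[OF PX])
    finally show "w * (m\<^sup>2 / (4 * N)) \<le> distorted_utility (capped_utility \<kappa> a B) (es_distortion \<alpha>) P X" .
  qed
  moreover have "0 < ereal (w * (m\<^sup>2 / (4 * N)))" using pos by simp
  ultimately show ?thesis by (rule less_le_trans[rotated])
qed

lemma Psi_min_capped_threshold_above_mean:
  assumes "\<mu> < a"
  shows "distorted_utility (capped_utility \<kappa> a B) (es_distortion \<alpha>) (two_point_law \<mu> \<sigma> (a - \<mu>)) (\<lambda>x. x) = 0"
    and "AE x in two_point_law \<mu> \<sigma> (a - \<mu>). x \<le> a"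
    and "Psi_min (capped_utility \<kappa> a B) (es_distortion \<alpha>) \<mu> \<sigma> = 0"
proof -
  have h: "a - \<mu> > 0" using assms by simp
  have low: "\<mu> - \<sigma>\<^sup>2 / (a - \<mu>) < a" using two_point_law_atoms_less[OF \<sigma> h, of \<mu>] by simp
  show 1: "distorted_utility (capped_utility \<kappa> a B) (es_distortion \<alpha>) (two_point_law \<mu> \<sigma> (a - \<mu>)) (\<lambda>x. x) = 0"
    using low B by (simp add: distorted_utility_two_point_law[OF \<sigma> h _ \<alpha>] capped_utility_eq_0)
  show "AE x in two_point_law \<mu> \<sigma> (a - \<mu>). x \<le> a"
    using AE_two_point_law[OF \<sigma> h, of \<mu>] by eventually_elim (use low in auto)
  show "Psi_min (capped_utility \<kappa> a B) (es_distortion \<alpha>) \<mu> \<sigma> = 0"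
    using Psi_min_le[OF two_point_law_moment_class[OF \<sigma> h],
        where U = "capped_utility \<kappa> a B" and \<phi> = "es_distortion \<alpha>" and \<mu> = \<mu>]
    by (intro antisym Psi_min_capped_nonneg) (simp add: 1 zero_ereal_def)
qed

text \<open>
  As the upper atom decreases to the mean, the lower atom escapes to \<open>-\<infinity>\<close> with vanishing weight,
  and the utility of the upper atom tends to \<open>0\<close>.
\<close>

lemma Psi_min_capped_threshold_at_mean:
  assumes "a = \<mu>"
  shows "(\<lambda>n. distorted_utility (capped_utility \<kappa> a B) (es_distortion \<alpha>)
             (two_point_law \<mu> \<sigma> (1 / real (Suc n))) (\<lambda>x. x)) \<longlonglongrightarrow> 0" (is "?M \<longlonglongrightarrow> 0")
    and "Psi_min (capped_utility \<kappa> a B) (es_distortion \<alpha>) \<mu> \<sigma> = 0"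
proof -
  let ?U = "capped_utility \<kappa> a B"
  have le: "?M n \<le> \<kappa> * (1 / real (Suc n))" for n
  proof -
    define h where "h = 1 / real (Suc n)"
    define v where "v = max \<alpha> (h\<^sup>2 / (\<sigma>\<^sup>2 + h\<^sup>2))"
    have h: "h > 0" by (simp add: h_def)
    have v: "1 - v \<le> 1 - \<alpha>" by (simp add: v_def)
    have "?U (\<mu> - \<sigma>\<^sup>2 / h) = 0" using h B assms by (intro capped_utility_eq_0) auto
    then have "?M n = ?U (\<mu> + h) * ((1 - v) / (1 - \<alpha>))"
      by (simp add: distorted_utility_two_point_law[OF \<sigma> h _ \<alpha>] v_def flip: h_def del: of_nat_Suc)
    also have "\<dots> \<le> ?U (\<mu> + h) * 1"
      using v \<alpha> by (intro mult_left_mono capped_utility_nonneg \<kappa> B) simp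
    also have "\<dots> \<le> \<kappa> * h"
      using h assms capped_utility_le(1)[of \<kappa> a B "\<mu> + h"] by (simp add: uncapped_utility_def)
    finally show ?thesis by (simp add: h_def)
  qed
  have "(\<lambda>n. \<kappa> * (1 / real (Suc n))) \<longlonglongrightarrow> \<kappa> * 0"
    by (intro tendsto_mult tendsto_const LIMSEQ_Suc[OF lim_1_over_n])
  then have ub: "(\<lambda>n. \<kappa> * (1 / real (Suc n))) \<longlonglongrightarrow> 0" by (simp only: mult_zero_right)
  have nn: "0 \<le> ?M n" for n
    by (intro distorted_utility_nonneg capped_utility_nonneg \<kappa> B)
  show lim: "?M \<longlonglongrightarrow> 0"
    by (rule tendsto_sandwich[OF _ _ tendsto_const ub]) (use le nn in \<open>blast intro: always_eventually\<close>)+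
  have "Psi_min ?U (es_distortion \<alpha>) \<mu> \<sigma> \<le> ereal 0"
  proof (rule LIMSEQ_le_const)
    show "(\<lambda>n. ereal (?M n)) \<longlonglongrightarrow> ereal 0" by (rule tendsto_ereal[OF lim])
    have "Psi_min ?U (es_distortion \<alpha>) \<mu> \<sigma> \<le> ereal (?M n)" for n
      by (intro Psi_min_le two_point_law_moment_class \<sigma>) simp
    then show "\<exists>N. \<forall>n\<ge>N. Psi_min ?U (es_distortion \<alpha>) \<mu> \<sigma> \<le> ereal (?M n)" by blast
  qed
  then show "Psi_min ?U (es_distortion \<alpha>) \<mu> \<sigma> = 0"
    by (intro antisym Psi_min_capped_nonneg) (simp add: zero_ereal_def)
qed

end

section \<open>The extremal values\<close>

theorem proposition6:
  fixes \<mu> \<sigma> a \<kappa> B \<alpha> :: real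
  assumes "\<sigma> > 0" and "\<kappa> > 0" and "B > 0" and "0 < \<alpha>" and "\<alpha> < 1"
  shows "let U = capped_utility \<kappa> a B; abar = a + B / \<kappa>; \<phi> = es_distortion \<alpha>;
             U\<alpha> = U_level \<mu> \<sigma> \<alpha>; S = S_value \<mu> \<sigma> \<kappa> \<alpha>
    in Psi_max (uncapped_utility \<kappa> a) \<phi> \<mu> \<sigma> = ereal (S a)
     \<and> Psi_max U \<phi> \<mu> \<sigma> =
         ereal (if abar \<le> U\<alpha> then B
                else if sqrt ((a - \<mu>)\<^sup>2 + \<sigma>\<^sup>2) \<ge> B / \<kappa>
                  then B * \<sigma>\<^sup>2 / ((1 - \<alpha>) * (\<sigma>\<^sup>2 + (abar - \<mu>)\<^sup>2))
                else S a)
     \<and> (\<exists>(P :: real measure) X. (P, X) \<in> moment_class \<mu> \<sigma> \<and> two_point P X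
          \<and> ereal (distorted_utility U \<phi> P X) = Psi_max U \<phi> \<mu> \<sigma>)
     \<and> (a \<ge> \<mu> \<longrightarrow> Psi_min U \<phi> \<mu> \<sigma> = 0)
     \<and> (a > \<mu> \<longrightarrow> (\<exists>(P :: real measure) X. (P, X) \<in> moment_class \<mu> \<sigma> \<and> two_point P X
          \<and> (AE \<omega> in P. X \<omega> \<le> a)
          \<and> ereal (distorted_utility U \<phi> P X) = Psi_min U \<phi> \<mu> \<sigma>))
     \<and> (a = \<mu> \<longrightarrow>
          (\<exists>(P :: nat \<Rightarrow> real measure) X. (\<forall>n. (P n, X n) \<in> moment_class \<mu> \<sigma> \<and> two_point (P n) (X n))
             \<and> (\<lambda>n. ereal (distorted_utility U \<phi> (P n) (X n))) \<longlonglongrightarrow> Psi_min U \<phi> \<mu> \<sigma>)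
          \<and> (\<forall>(P :: real measure) X. (P, X) \<in> moment_class \<mu> \<sigma> \<longrightarrow>
               ereal (distorted_utility U \<phi> P X) \<noteq> Psi_min U \<phi> \<mu> \<sigma>))
     \<and> (a < \<mu> \<longrightarrow> Psi_min U \<phi> \<mu> \<sigma> > 0)"
proof -
  let ?U = "capped_utility \<kappa> a B" and ?\<phi> = "es_distortion \<alpha>"
  have min0: "Psi_min ?U ?\<phi> \<mu> \<sigma> = 0" if "\<mu> \<le> a"
    using that Psi_min_capped_threshold_above_mean(3)[OF assms] Psi_min_capped_threshold_at_mean(2)[OF assms]
    by (cases "a = \<mu>") auto
  have above: "\<exists>(P :: real measure) X. (P, X) \<in> moment_class \<mu> \<sigma> \<and> two_point P X
      \<and> (AE \<omega> in P. X \<omega> \<le> a) \<and> ereal (distorted_utility ?U ?\<phi> P X) = Psi_min ?U ?\<phi> \<mu> \<sigma>"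
    if "\<mu> < a"
  proof (intro exI conjI)
    have h: "a - \<mu> > 0" using that by simp
    show "(two_point_law \<mu> \<sigma> (a - \<mu>), \<lambda>x. x) \<in> moment_class \<mu> \<sigma>"
      by (rule two_point_law_moment_class[OF assms(1) h])
    show "two_point (two_point_law \<mu> \<sigma> (a - \<mu>)) (\<lambda>x. x)"
      by (rule two_point_two_point_law[OF assms(1) h])
  qed (use Psi_min_capped_threshold_above_mean[OF assms that] in \<open>auto simp: zero_ereal_def\<close>)
  have at: "\<exists>(P :: nat \<Rightarrow> real measure) X.
      (\<forall>n. (P n, X n) \<in> moment_class \<mu> \<sigma> \<and> two_point (P n) (X n))
      \<and> (\<lambda>n. ereal (distorted_utility ?U ?\<phi> (P n) (X n))) \<longlonglongrightarrow> Psi_min ?U ?\<phi> \<mu> \<sigma>"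
    if "a = \<mu>"
  proof (intro exI conjI allI)
    fix n
    have h: "1 / real (Suc n) > 0" by simp
    show "(two_point_law \<mu> \<sigma> (1 / real (Suc n)), \<lambda>x. x) \<in> moment_class \<mu> \<sigma>"
      by (rule two_point_law_moment_class[OF assms(1) h])
    show "two_point (two_point_law \<mu> \<sigma> (1 / real (Suc n))) (\<lambda>x. x)"
      by (rule two_point_two_point_law[OF assms(1) h])
  next
    show "(\<lambda>n. ereal (distorted_utility ?U ?\<phi> (two_point_law \<mu> \<sigma> (1 / real (Suc n))) (\<lambda>x. x)))
        \<longlonglongrightarrow> Psi_min ?U ?\<phi> \<mu> \<sigma>"
      unfolding Psi_min_capped_threshold_at_mean(2)[OF assms that] zero_ereal_def
      by (rule tendsto_ereal[OF Psi_min_capped_threshold_at_mean(1)[OF assms that]])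
  qed
  have not_attained: "ereal (distorted_utility ?U ?\<phi> P X) \<noteq> Psi_min ?U ?\<phi> \<mu> \<sigma>"
    if "a = \<mu>" "(P, X) \<in> moment_class \<mu> \<sigma>" for P :: "real measure" and X
    using distorted_utility_pos_of_threshold_le_mean[OF assms that(2), of a] that(1) min0 by (auto simp: zero_ereal_def)
  show ?thesis
    unfolding Let_def
  proof (intro conjI impI)
    show "Psi_max (uncapped_utility \<kappa> a) ?\<phi> \<mu> \<sigma> = ereal (S_value \<mu> \<sigma> \<kappa> \<alpha> a)"
      by (rule Psi_max_uncapped[OF assms(1,2,4,5)])
  qed (fact Psi_max_capped[OF assms] min0 above at Psi_min_capped_threshold_below_mean[OF assms]
      | use not_attained in blast)+
qed

end
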